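(* Let $\mathbf{H}\in\mathbb{R}^{d\times d}$ be symmetric positive definite with $\lambda_{\min}(\mathbf{H})\ge \mu>0$, and let $\mathbf{g}\in\mathbb{R}^d$. Let $\tilde{\mathbf{H}}=\mathbf{H}+\mathbf{E}$ and $\tilde{\mathbf{g}}=\mathbf{g}+\mathbf{e}$, where $\mathbf{E}\in\mathbb{R}^{d\times d}$ and $\mathbf{e}\in\mathbb{R}^d$ satisfy $\|\mathbf{E}\|_2\le\varepsilon<\mu$ and $\|\mathbf{e}\|_2\le\rho$. Set $\boldsymbol{\delta}^\star=-\mathbf{H}^{-1}\mathbf{g}$ and $\tilde{\boldsymbol{\delta}}^\star=-\tilde{\mathbf{H}}^{-1}\tilde{\mathbf{g}}$. Then $$\|\tilde{\boldsymbol{\delta}}^\star-\boldsymbol{\delta}^\star\|_2\le \frac{\varepsilon}{\mu(\mu-\varepsilon)}\,\|\mathbf{g}\|_2+\frac{\rho}{\mu-\varepsilon}.$$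
   Context: For vectors $\|\cdot\|_2$ is the Euclidean norm and for matrices it is the induced operator (spectral) norm; $\lambda_{\min}$ denotes the smallest eigenvalue of a symmetric matrix. *)

theory Defs
  imports "HOL-Analysis.Analysis"
begin

definition sym_pos_def :: "real^'n^'n \<Rightarrow> bool" where
  "sym_pos_def A \<longleftrightarrow> transpose A = A \<and> (\<forall>x. x \<noteq> 0 \<longrightarrow> x \<bullet> (A *v x) > 0)"

definition eigenvalues :: "real^'n^'n \<Rightarrow> real set" where
  "eigenvalues A = {l. \<exists>v. v \<noteq> 0 \<and> A *v v = l *\<^sub>R v}"

(* Meaningful for symmetric A, whose set of real eigenvalues is finite and nonempty;
   Min is unspecified on the empty set. *)
definition lambda_min :: "real^'n^'n \<Rightarrow> real" where
  "lambda_min A = Min (eigenvalues A)"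

definition spectral_norm :: "real^'n^'m \<Rightarrow> real" where
  "spectral_norm A = onorm (\<lambda>x. A *v x)"

end

theory Submission
  imports Defs
begin

text \<open>The quadratic form of \<open>H\<close> attains its minimum \<open>m\<close> on the unit sphere at an eigenvector with
  eigenvalue \<open>m\<close>, so \<open>\<mu> \<le> m\<close> and therefore \<open>\<mu> \<bar>x\<bar> \<le> \<bar>H x\<bar>\<close> and \<open>(\<mu> - \<epsilon>) \<bar>x\<bar> \<le> \<bar>H' x\<bar>\<close>. These bounds give
  invertibility, and applied to \<open>H \<delta> = - g\<close> and \<open>H' (\<delta>' - \<delta>) = - e - E \<delta>\<close> they give the estimate.\<close>

lemma symmetric_inner_matrix_vector_mult:
  fixes A :: "real^'n^'n"
  assumes "transpose A = A"
  shows "x \<bullet> (A *v y) = (A *v x) \<bullet> y"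
  by (metis assms dot_lmul_matrix vector_transpose_matrix)

text \<open>Eigenvectors chosen for distinct eigenvalues are nonzero and pairwise orthogonal, hence
  independent, and an independent set in \<open>real^'n\<close> is finite. Finiteness is what lets
  \<open>Min\<close> in \<open>lambda_min\<close> be compared with single eigenvalues.\<close>

lemma finite_eigenvalues_symmetric:
  fixes A :: "real^'n^'n"
  assumes sym: "transpose A = A"
  shows "finite (eigenvalues A)"
proof -
  have "\<forall>l\<in>eigenvalues A. \<exists>v. v \<noteq> 0 \<and> A *v v = l *\<^sub>R v"
    by (simp add: eigenvalues_def)
  then obtain v where v: "\<And>l. l \<in> eigenvalues A \<Longrightarrow> v l \<noteq> 0 \<and> A *v v l = l *\<^sub>R v l"
    by metis
  have orth: "v k \<bullet> v l = 0" if "k \<in> eigenvalues A" "l \<in> eigenvalues A" "k \<noteq> l" for k l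
  proof -
    have "l * (v k \<bullet> v l) = k * (v k \<bullet> v l)"
      using symmetric_inner_matrix_vector_mult[OF sym, of "v k" "v l"] v that by simp
    with \<open>k \<noteq> l\<close> show ?thesis by simp
  qed
  have "inj_on v (eigenvalues A)"
    by (rule inj_onI) (metis orth v inner_eq_zero_iff)
  moreover have "independent (v ` eigenvalues A)"
    using orth v
    by (intro pairwise_orthogonal_independent) (auto simp: pairwise_def orthogonal_def)
  then have "finite (v ` eigenvalues A)"
    by (rule independent_imp_finite)
  ultimately show ?thesis
    using finite_image_iff by blast
qed

text \<open>Such an \<open>x\<close> minimises the form, so the first variation vanishes there.
  Moving from \<open>x\<close> in the direction \<open>y = B *v x\<close> has linear coefficient
  \<open>2 * a\<close>, where \<open>a\<close> is the squared norm of \<open>B *v x\<close>.\<close>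

lemma psd_form_zero_imp_kernel:
  fixes B :: "real^'n^'n"
  assumes sym: "transpose B = B"
    and psd: "\<And>x. x \<bullet> (B *v x) \<ge> 0"
    and zero: "x \<bullet> (B *v x) = 0"
  shows "B *v x = 0"
proof -
  define y where "y = B *v x"
  define a where "a = y \<bullet> y"
  define c where "c = y \<bullet> (B *v y)"
  have c: "c \<ge> 0"
    unfolding c_def by (rule psd)
  have "0 \<le> 2 * t * a + t\<^sup>2 * c" for t
  proof -
    have "x \<bullet> (B *v y) = a"
      unfolding symmetric_inner_matrix_vector_mult[OF sym] by (simp add: a_def y_def)
    moreover have "y \<bullet> (B *v x) = a"
      by (simp add: a_def y_def)
    ultimately have "(x + t *\<^sub>R y) \<bullet> (B *v (x + t *\<^sub>R y)) = 2 * t * a + t\<^sup>2 * c"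
      using zero
      by (simp add: matrix_vector_right_distrib matrix_vector_mult_scaleR inner_add_left
          inner_add_right c_def power2_eq_square algebra_simps)
    then show ?thesis
      using psd[of "x + t *\<^sub>R y"] by simp
  qed
  \<comment> \<open>The inequality is used at \<open>t = - s\<close>. The quadratic is least at
    \<open>- a / c\<close> when \<open>c > 0\<close>; the denominator \<open>c + 1\<close> also
    covers \<open>c = 0\<close>.\<close>
  moreover define s where "s = a / (c + 1)"
  moreover have a: "a = s * (c + 1)"
    using c by (simp add: s_def)
  ultimately have "0 \<le> 2 * (- s) * (s * (c + 1)) + (- s)\<^sup>2 * c"
    by metis
  also have "\<dots> = - (s\<^sup>2 * (c + 2))"
    by (simp add: algebra_simps power2_eq_square)
  finally have "s\<^sup>2 * (c + 2) \<le> 0"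
    by simp
  then have "a = 0"
    using c by (auto simp: a mult_le_0_iff)
  then show ?thesis
    by (simp add: a_def y_def)
qed

text \<open>Compactness of the sphere provides the minimiser \<open>u\<close>, and homogeneity
  carries the bound by \<open>m\<close> from the sphere to all vectors.\<close>

lemma lambda_min_le_quadratic_form:
  fixes A :: "real^'n^'n"
  assumes sym: "transpose A = A"
  shows "lambda_min A * (norm x)\<^sup>2 \<le> x \<bullet> (A *v x)"
proof -
  have "continuous_on (sphere 0 1) (\<lambda>x. x \<bullet> (A *v x))"
    by (intro continuous_intros linear_continuous_on matrix_vector_mul_bounded_linear)
  then obtain u where u: "norm u = 1"
    and least: "\<And>y. norm y = 1 \<Longrightarrow> u \<bullet> (A *v u) \<le> y \<bullet> (A *v y)"
    using continuous_attains_inf[of "sphere (0 :: real^'n) 1" "\<lambda>x. x \<bullet> (A *v x)"] by auto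
  define m where "m = u \<bullet> (A *v u)"
  have m_le: "m * (norm y)\<^sup>2 \<le> y \<bullet> (A *v y)" for y
  proof (cases "y = 0")
    case False
    then have "m \<le> (y /\<^sub>R norm y) \<bullet> (A *v (y /\<^sub>R norm y))"
      unfolding m_def by (intro least) simp
    also have "\<dots> = (y \<bullet> (A *v y)) / (norm y)\<^sup>2"
      by (simp add: matrix_vector_mult_scaleR power2_eq_square field_simps)
    finally show ?thesis
      using False by (simp add: field_simps)
  qed simp
  \<comment> \<open>The shifted form is nonnegative and vanishes at \<open>u\<close>, so
    \<open>u\<close> lies in the kernel of \<open>B\<close>; this takes the place of a Lagrange
    multiplier argument.\<close>
  define B where "B = A - m *\<^sub>R mat 1"
  have B: "B *v y = A *v y - m *\<^sub>R y" for y
    by (simp add: B_def matrix_vector_mult_diff_rdistrib scaleR_matrix_vector_assoc[symmetric])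
  have "B *v u = 0"
  proof (rule psd_form_zero_imp_kernel)
    show "transpose B = B"
      using sym by (simp add: B_def transpose_def vec_eq_iff mat_def)
    show "y \<bullet> (B *v y) \<ge> 0" for y
      using m_le[of y] by (simp add: B inner_diff_right power2_norm_eq_inner)
    show "u \<bullet> (B *v u) = 0"
      using u by (simp add: B inner_diff_right m_def norm_eq_1)
  qed
  then have "m \<in> eigenvalues A"
    using u unfolding eigenvalues_def B by (auto intro!: exI[of _ u])
  then have "lambda_min A \<le> m"
    unfolding lambda_min_def by (intro Min_le finite_eigenvalues_symmetric sym)
  then have "lambda_min A * (norm x)\<^sup>2 \<le> m * (norm x)\<^sup>2"
    by (intro mult_right_mono) simp_all
  with m_le[of x] show ?thesis
    by linarith
qed

text \<open>The lower bound forces a trivial kernel, which for a square matrix is enough.\<close>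

lemma invertible_if_bounded_below:
  fixes A :: "real^'n^'n"
  assumes "c > 0" and "\<And>x. c * norm x \<le> norm (A *v x)"
  shows "invertible A"
  unfolding invertible_left_inverse matrix_left_invertible_ker
  using assms by (metis mult_le_0_iff norm_eq_zero norm_le_zero_iff not_less)

text \<open>\<open>matrix_inv\<close> is a Hilbert choice; invertibility supplies the witness that
  makes the chosen matrix a genuine inverse.\<close>

lemma matrix_inv_vector_mult_cancel:
  fixes A :: "real^'n^'n"
  assumes "invertible A"
  shows "A *v (matrix_inv A *v x) = x"
  using assms someI_ex[of "\<lambda>B. A ** B = mat 1 \<and> B ** A = mat 1"]
  by (simp add: matrix_vector_mul_assoc matrix_inv_def invertible_def)

theorem theorem1:
  fixes H E H' :: "real^'d^'d"
    and g e g' \<delta> \<delta>' :: "real^'d"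
    and \<mu> \<epsilon> \<rho> :: real
  assumes "sym_pos_def H"
    and "lambda_min H \<ge> \<mu>" and "\<mu> > 0"
    and "H' = H + E" and "g' = g + e"
    and "spectral_norm E \<le> \<epsilon>" and "\<epsilon> < \<mu>"
    and "norm e \<le> \<rho>"
    and "\<delta> = - (matrix_inv H *v g)"
    and "\<delta>' = - (matrix_inv H' *v g')"
  shows "invertible H \<and> invertible H' \<and>
    norm (\<delta>' - \<delta>) \<le> \<epsilon> / (\<mu> * (\<mu> - \<epsilon>)) * norm g + \<rho> / (\<mu> - \<epsilon>)"
proof -
  have H_below: "\<mu> * norm x \<le> norm (H *v x)" for x
  proof (cases "x = 0")
    case False
    have "\<mu> * norm x * norm x \<le> lambda_min H * (norm x)\<^sup>2"
      using assms(2) by (simp add: power2_eq_square mult_right_mono mult.assoc)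
    also have "\<dots> \<le> x \<bullet> (H *v x)"
      using assms(1) unfolding sym_pos_def_def by (blast intro: lambda_min_le_quadratic_form)
    also have "\<dots> \<le> norm (H *v x) * norm x"
      by (metis norm_cauchy_schwarz mult.commute)
    finally show ?thesis
      using False by simp
  qed simp
  have E_above: "norm (E *v x) \<le> \<epsilon> * norm x" for x
  proof -
    have "norm (E *v x) \<le> spectral_norm E * norm x"
      unfolding spectral_norm_def by (intro onorm matrix_vector_mul_bounded_linear)
    also have "\<dots> \<le> \<epsilon> * norm x"
      using assms(6) by (intro mult_right_mono) simp_all
    finally show ?thesis .
  qed
  have H'_below: "(\<mu> - \<epsilon>) * norm x \<le> norm (H' *v x)" for x
  proof -
    have "norm (H *v x) \<le> norm (H' *v x) + norm (E *v x)"
      using norm_triangle_ineq4[of "H' *v x" "E *v x"]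
      by (simp add: assms(4) matrix_vector_mult_add_rdistrib)
    with H_below[of x] E_above[of x] show ?thesis
      by (simp add: left_diff_distrib)
  qed
  have inv: "invertible H" "invertible H'"
    using H_below H'_below assms(3,7) by (auto intro: invertible_if_bounded_below diff_gt_0_iff_gt[THEN iffD2])
  \<comment> \<open>This sign is needed below to multiply the bound on \<open>norm \<delta>\<close>
    by \<open>\<epsilon>\<close>.\<close>
  have \<epsilon>: "\<epsilon> \<ge> 0"
    using assms(6) onorm_pos_le[of "\<lambda>x. E *v x"]
    by (simp add: spectral_norm_def matrix_vector_mul_bounded_linear)
  have H\<delta>: "H *v \<delta> = - g" and H'\<delta>': "H' *v \<delta>' = - g'"
    using matrix_inv_vector_mult_cancel[OF inv(1), of "- g"]
      matrix_inv_vector_mult_cancel[OF inv(2), of "- g'"] assms(9,10)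
    by (simp_all add: linear_neg)
  \<comment> \<open>Here \<open>H' *v \<delta>' = - g - e\<close> and
    \<open>H' *v \<delta> = - g + E *v \<delta>\<close>, so \<open>g\<close> cancels and only the
    perturbations remain.\<close>
  have "H' *v (\<delta>' - \<delta>) = - e - E *v \<delta>"
    using H'\<delta>' H\<delta> assms(4,5)
    by (simp add: matrix_vector_mult_diff_distrib matrix_vector_mult_add_rdistrib)
  then have "(\<mu> - \<epsilon>) * norm (\<delta>' - \<delta>) \<le> norm (- e - E *v \<delta>)"
    using H'_below[of "\<delta>' - \<delta>"] by simp
  also have "\<dots> \<le> \<rho> + \<epsilon> * norm \<delta>"
    using norm_triangle_ineq4[of "- e" "E *v \<delta>"] E_above[of \<delta>] assms(8) by simp
  also have "norm \<delta> \<le> norm g / \<mu>"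
    using H_below[of \<delta>] assms(3) by (simp add: H\<delta> field_simps)
  finally have "(\<mu> - \<epsilon>) * norm (\<delta>' - \<delta>) \<le> \<rho> + \<epsilon> * (norm g / \<mu>)"
    using \<epsilon> by (simp add: mult_left_mono)
  then have "norm (\<delta>' - \<delta>) \<le> (\<rho> + \<epsilon> * (norm g / \<mu>)) / (\<mu> - \<epsilon>)"
    using assms(7) by (simp add: pos_le_divide_eq mult.commute)
  also have "\<dots> = \<epsilon> / (\<mu> * (\<mu> - \<epsilon>)) * norm g + \<rho> / (\<mu> - \<epsilon>)"
    by (simp add: add_divide_distrib)
  finally show ?thesis
    using inv by simp
qed

end
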